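(* For all $1\le p\le\infty$ we have $C_{2,p}=\frac12$. Moreover, with $S_m:=\{0,3,6,\dots,3(m-1)\}$, the sequence $(\chi_{S_m})_{m\in\mathbb{N}}$ is extremizing, i.e. $$C_{2,p}=\lim_{m\to\infty}\frac{\|(\mathcal{M}\chi_{S_m})''\|_{\ell^p(\mathbb{Z})}}{\|\chi_{S_m}''\|_{\ell^p(\mathbb{Z})}}.$$
   Context: An interval in $\mathbb{Z}$ is a nonempty finite set of consecutive integers. For $f:\mathbb{Z}\to\mathbb{R}$ the discrete uncentered maximal function is $\mathcal{M}f(n)=\sup_{I\ni n}\frac1{|I|}\sum_{i\in I}|f(i)|$, the supremum being over all intervals $I\subset\mathbb{Z}$ containing $n$, with $|I|$ the cardinality of $I$. Discrete derivatives: $f'(n)=f(n+1)-f(n)$ and $f''=(f')'$, so $f''(n)=f(n+2)-2f(n+1)+f(n)$. For $S\subseteq\mathbb{Z}$, $\chi_S$ is its characteristic function. For $1\le p\le\infty$, $C_{2,p}\in[0,\infty]$ is the smallest number such that $\|(\mathcal{M}\chi_S)''\|_{\ell^p(\mathbb{Z})}\le C_{2,p}\|\chi_S''\|_{\ell^p(\mathbb{Z})}$ for all $S\subseteq\mathbb{Z}$ with $\|\chi_S''\|_{\ell^p(\mathbb{Z})}<\infty$. *)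

theory Defs
  imports "HOL-Analysis.Analysis"
begin

definition int_intervals :: "int set set" where
  "int_intervals = {{a..b} | a b. a \<le> b}"

text \<open>The supremum is taken in \<open>\<real>\<close>, so this is the maximal function whenever the averages at
  \<open>n\<close> are bounded above; \<open>bdd_above_averages\<close> shows that this is so for every bounded \<open>f\<close>.\<close>

definition maximal_fun :: "(int \<Rightarrow> real) \<Rightarrow> int \<Rightarrow> real" where
  "maximal_fun f n =
     (SUP I\<in>{I \<in> int_intervals. n \<in> I}. (\<Sum>i\<in>I. \<bar>f i\<bar>) / real (card I))"

lemma bdd_above_averages:
  fixes f :: "int \<Rightarrow> real"
  assumes "\<And>i. \<bar>f i\<bar> \<le> B"
  shows "bdd_above ((\<lambda>I. (\<Sum>i\<in>I. \<bar>f i\<bar>) / real (card I)) ` {I \<in> int_intervals. n \<in> I})"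
proof (rule bdd_aboveI2)
  fix I assume "I \<in> {I \<in> int_intervals. n \<in> I}"
  then have "finite I" "I \<noteq> {}" by (auto simp: int_intervals_def)
  then have "card I > 0" by (simp add: card_gt_0_iff)
  moreover have "(\<Sum>i\<in>I. \<bar>f i\<bar>) \<le> real (card I) * B"
    by (rule sum_bounded_above) (rule assms)
  ultimately show "(\<Sum>i\<in>I. \<bar>f i\<bar>) / real (card I) \<le> B"
    by (simp add: divide_le_eq mult.commute)
qed

definition ddiff :: "(int \<Rightarrow> real) \<Rightarrow> int \<Rightarrow> real" where
  "ddiff f n = f (n + 1) - f n"

text \<open>The \<open>\<ell>\<^sup>p(\<int>)\<close> norm with values in \<open>[0, \<infinity>]\<close>, intended for \<open>1 \<le> p \<le> \<infinity>\<close>. The case distinction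
  on the sum is there because \<open>powr\<close> is not available on \<^typ>\<open>ennreal\<close>.\<close>

definition lp_norm :: "ennreal \<Rightarrow> (int \<Rightarrow> real) \<Rightarrow> ennreal" where
  "lp_norm p f =
     (if p = \<infinity> then (SUP n. ennreal \<bar>f n\<bar>)
      else (let s = (\<Sum>\<^sub>\<infinity>n\<in>UNIV. ennreal (\<bar>f n\<bar> powr enn2real p)) in
            if s = \<infinity> then \<infinity> else ennreal (enn2real s powr (1 / enn2real p))))"

definition C2 :: "ennreal \<Rightarrow> ennreal" where
  "C2 p = (LEAST C. \<forall>S :: int set.
     lp_norm p (ddiff (ddiff (indicator S))) < \<infinity> \<longrightarrow>
     lp_norm p (ddiff (ddiff (maximal_fun (indicator S))))
       \<le> C * lp_norm p (ddiff (ddiff (indicator S))))"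

definition S_ext :: "nat \<Rightarrow> int set" where
  "S_ext m = (\<lambda>k. 3 * int k) ` {..<m}"

end

theory Submission
  imports Defs
begin

text \<open>On \<open>S\<close> the maximal function \<open>M\<close> of \<open>\<chi>\<^sub>S\<close> attains its maximum \<open>1\<close> and next to \<open>S\<close> it is at
  least \<open>1/2\<close>, which gives \<open>\<bar>M''\<bar> \<le> \<bar>\<chi>\<^sub>S''\<bar> / 2\<close> at the points of \<open>S\<close>. Off \<open>S\<close>, \<open>M\<close> is convex.
  There \<open>0 \<le> M'' \<le> 1/2\<close> except on gaps of length one, where \<open>M'' \<le> 1 = \<chi>\<^sub>S'' / 2\<close>, so that
  \<open>(M'')\<^sup>p \<le> 2\<^bsup>1-p\<^esup> M''\<close> on longer gaps. Telescoping the sum of \<open>M''\<close> over such a gap yields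
  at most \<open>1/2\<close> per end of the gap, and each end is a point where \<open>\<chi>\<^sub>S'' = 1\<close>. For \<open>S\<^sub>m\<close>,
  \<open>M\<close> equals \<open>1/2\<close> on the gaps, so \<open>\<bar>M''\<bar> \<ge> \<bar>\<chi>\<^sub>S''\<bar> / 2\<close> at all points between the first and the last
  point of \<open>S\<^sub>m\<close>; only two points of the support of \<open>\<chi>\<^sub>S''\<close> lie outside that range.\<close>

section \<open>The maximal function of a characteristic function: basic bounds\<close>

abbreviation Mchi :: "int set \<Rightarrow> int \<Rightarrow> real" where
  "Mchi S \<equiv> maximal_fun (indicator S)"

lemma average_indicator:
  fixes S :: "int set"
  assumes "a \<le> b"
  shows "(\<Sum>i\<in>{a..b}. \<bar>indicator S i :: real\<bar>) / real (card {a..b}) =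
    real (card (S \<inter> {a..b})) / real_of_int (b - a + 1)"
proof -
  have "(\<Sum>i\<in>{a..b}. \<bar>indicator S i :: real\<bar>) = (\<Sum>i\<in>{a..b}. indicator S i)"
    by simp
  also have "\<dots> = real (card (S \<inter> {a..b}))"
    by (simp add: indicator_def sum.If_cases Int_commute)
  finally show ?thesis using assms by simp
qed

text \<open>Together with \<open>maximal_leI\<close> this is the only access to the supremum used
  below: averages become counts of points of S divided by lengths.\<close>

lemma average_le_maximal:
  fixes S :: "int set"
  assumes "a \<le> n" "n \<le> b"
  shows "real (card (S \<inter> {a..b})) / real_of_int (b - a + 1) \<le> Mchi S n"
proof -
  have "(\<Sum>i\<in>{a..b}. \<bar>indicator S i :: real\<bar>) / real (card {a..b}) \<le> Mchi S n"
    unfolding maximal_fun_def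
    by (rule cSUP_upper, use assms in \<open>force simp: int_intervals_def\<close>,
        rule bdd_above_averages[where B = 1]) (simp add: indicator_def)
  then show ?thesis using assms by (simp only: average_indicator)
qed

lemma maximal_leI:
  fixes S :: "int set"
  assumes "\<And>a b. a \<le> n \<Longrightarrow> n \<le> b \<Longrightarrow>
    real (card (S \<inter> {a..b})) / real_of_int (b - a + 1) \<le> C"
  shows "Mchi S n \<le> C"
  unfolding maximal_fun_def
proof (rule cSUP_least)
  have "{n..n} \<in> {I \<in> int_intervals. n \<in> I}"
    unfolding int_intervals_def by (auto intro!: exI[of _ n])
  then show "{I \<in> int_intervals. n \<in> I} \<noteq> {}" by blast
next
  fix I assume "I \<in> {I \<in> int_intervals. n \<in> I}"
  then obtain a b where "I = {a..b}" "a \<le> n" "n \<le> b" by (auto simp: int_intervals_def)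
  then show "(\<Sum>i\<in>I. \<bar>indicator S i :: real\<bar>) / real (card I) \<le> C"
    using assms[of a b] by (simp only: average_indicator)
qed

lemma card_Int_atLeastAtMost_le:
  fixes S :: "int set"
  assumes "a \<le> b"
  shows "real (card (S \<inter> {a..b})) \<le> real_of_int (b - a + 1)"
proof -
  have "card (S \<inter> {a..b}) \<le> card {a..b}" by (intro card_mono) auto
  then show ?thesis using assms by simp
qed

lemma maximal_le_1: "Mchi S n \<le> 1"
proof (rule maximal_leI)
  fix a b assume "a \<le> n" "n \<le> b"
  then show "real (card (S \<inter> {a..b})) / real_of_int (b - a + 1) \<le> 1"
    using card_Int_atLeastAtMost_le[of a b S] by (simp add: divide_le_eq)
qed

lemma maximal_nonneg: "0 \<le> Mchi S n"
  by (rule order_trans[OF _ average_le_maximal[of n n n S]]) simp_all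

lemma maximal_eq_1:
  assumes "n \<in> S"
  shows "Mchi S n = 1"
proof (rule antisym)
  have "S \<inter> {n..n} = {n}" using assms by auto
  then show "1 \<le> Mchi S n" using average_le_maximal[of n n n S] by simp
qed (rule maximal_le_1)

text \<open>The two-point interval joining n to a neighbour in S has average at least 1/2.\<close>

lemma maximal_ge_half:
  assumes "n - 1 \<in> S \<or> n + 1 \<in> S"
  shows "1 / 2 \<le> Mchi S n"
proof -
  have *: "1 / 2 \<le> Mchi S n" if "a \<le> n" "n \<le> b" "b = a + 1" "x \<in> S \<inter> {a..b}" for a b x
  proof -
    have "card {x} \<le> card (S \<inter> {a..b})" using that(4) by (intro card_mono) auto
    then have "(1::real) / 2 \<le> real (card (S \<inter> {a..b})) / real_of_int (b - a + 1)"
      using that by simp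
    then show ?thesis using average_le_maximal[OF that(1,2), of S] by linarith
  qed
  from assms show ?thesis
    using *[of "n - 1" n "n - 1"] *[of n "n + 1" "n + 1"] by auto
qed

text \<open>Reflection carries intervals around n to intervals around -n; it supplies mirror images
  of the one-sided estimates below.\<close>

lemma maximal_uminus: "Mchi (uminus ` S) n = Mchi S (- n)"
proof -
  have card: "card (uminus ` S \<inter> {a..b}) = card (S \<inter> {-b..-a})" for S :: "int set" and a b
  proof -
    have "uminus ` S \<inter> {a..b} = uminus ` (S \<inter> {-b..-a})" by force
    then show ?thesis by (simp add: card_image)
  qed
  have le: "Mchi (uminus ` S) n \<le> Mchi S (- n)" for S n
  proof (rule maximal_leI)
    fix a b :: int assume "a \<le> n" "n \<le> b"
    then show "real (card (uminus ` S \<inter> {a..b})) / real_of_int (b - a + 1) \<le> Mchi S (- n)"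
      using average_le_maximal[of "-b" "-n" "-a" S] by (simp add: card add.commute)
  qed
  have "uminus ` uminus ` S = S" by (simp add: image_image)
  then show ?thesis using le[of S n] le[of "uminus ` S" "-n"] by simp
qed

section \<open>Second differences of the maximal function off S\<close>

lemma card_Int_remove_left:
  fixes S :: "int set"
  assumes "a \<notin> S"
  shows "card (S \<inter> {a..b}) = card (S \<inter> {a + 1..b})"
  by (rule arg_cong[where f = card]) (use assms in \<open>auto simp: order_le_less\<close>)

lemma card_Int_remove_right:
  fixes S :: "int set"
  assumes "b \<notin> S"
  shows "card (S \<inter> {a..b}) = card (S \<inter> {a..b - 1})"
  by (rule arg_cong[where f = card]) (use assms in \<open>auto simp: order_le_less\<close>)

lemma card_Int_le_remove_left:
  fixes S :: "int set"
  assumes "a \<notin> S" "a \<le> b"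
  shows "real (card (S \<inter> {a..b})) \<le> real_of_int (b - a)"
proof -
  have "card (S \<inter> {a..b}) \<le> card {a + 1..b}"
    unfolding card_Int_remove_left[OF assms(1)] by (intro card_mono) auto
  then show ?thesis using assms(2) by simp
qed

text \<open>An interval with n in its interior contains both neighbours. If n is only one of its
  ends, dropping n keeps the count c at length L - 1 and serves one neighbour, while adding the
  point beyond n gives at least c at length L + 1 and serves the other; then 2/L <= 1/(L - 1) + 1/(L
  + 1).\<close>

lemma maximal_convex_off:
  assumes "n \<notin> S"
  shows "2 * Mchi S n \<le> Mchi S (n - 1) + Mchi S (n + 1)"
proof -
  have aux: "2 * (c / L) \<le> x + y" if "c / (L - 1) \<le> x" "c / (L + 1) \<le> y" "L > 1" "c \<ge> 0"
    for c L x y :: real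
  proof -
    have "(L - 1) * (L + 1) \<le> L * L" by (simp add: algebra_simps)
    then have "2 * L * c / (L * L) \<le> 2 * L * c / ((L - 1) * (L + 1))"
      using that by (intro divide_left_mono) auto
    also have "\<dots> = c / (L - 1) + c / (L + 1)" using that by (simp add: field_simps)
    finally have "2 * (c / L) \<le> c / (L - 1) + c / (L + 1)" using that by simp
    then show ?thesis using that by linarith
  qed
  have "Mchi S n \<le> (Mchi S (n - 1) + Mchi S (n + 1)) / 2"
  proof (rule maximal_leI)
    fix a b assume ab: "a \<le> n" "n \<le> b"
    define c L where "c = real (card (S \<inter> {a..b}))" and "L = real_of_int (b - a + 1)"
    consider "a < n" "n < b" | "a = n" "b = n" | "a < n" "b = n" | "a = n" "n < b"
      using ab by linarith
    then have "2 * (c / L) \<le> Mchi S (n - 1) + Mchi S (n + 1)"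
    proof cases
      case 1
      then show ?thesis
        using average_le_maximal[of a "n - 1" b S] average_le_maximal[of a "n + 1" b S]
        unfolding c_def L_def by simp
    next
      case 2
      then have "c = 0" using assms by (simp add: c_def)
      then show ?thesis using maximal_nonneg[of S "n - 1"] maximal_nonneg[of S "n + 1"] by simp
    next
      case 3
      have "card (S \<inter> {a..n}) \<le> card (S \<inter> {a..n+1})" by (intro card_mono) auto
      then have "c / (L + 1) \<le> real (card (S \<inter> {a..n+1})) / (L + 1)"
        using 3 by (intro divide_right_mono) (auto simp: c_def L_def)
      also have "\<dots> \<le> Mchi S (n + 1)"
        using average_le_maximal[of a "n + 1" "n + 1" S] 3 by (simp add: L_def algebra_simps)
      finally have y: "c / (L + 1) \<le> Mchi S (n + 1)" .
      have "c / (L - 1) \<le> Mchi S (n - 1)"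
        using average_le_maximal[of a "n - 1" "n - 1" S] 3 card_Int_remove_right[of n S a] assms
        by (simp add: c_def L_def)
      then show ?thesis using y by (rule aux) (use 3 in \<open>auto simp: c_def L_def\<close>)
    next
      case 4
      have "card (S \<inter> {n..b}) \<le> card (S \<inter> {n-1..b})" by (intro card_mono) auto
      then have "c / (L + 1) \<le> real (card (S \<inter> {n-1..b})) / (L + 1)"
        using 4 by (intro divide_right_mono) (auto simp: c_def L_def)
      also have "\<dots> \<le> Mchi S (n - 1)"
        using average_le_maximal[of "n - 1" "n - 1" b S] 4 by (simp add: L_def algebra_simps)
      finally have y: "c / (L + 1) \<le> Mchi S (n - 1)" .
      have "c / (L - 1) \<le> Mchi S (n + 1)"
        using average_le_maximal[of "n + 1" "n + 1" b S] 4 card_Int_remove_left[of n S b] assms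
        by (simp add: c_def L_def)
      then have "2 * (c / L) \<le> Mchi S (n + 1) + Mchi S (n - 1)"
        using y by (rule aux) (use 4 in \<open>auto simp: c_def L_def\<close>)
      then show ?thesis by simp
    qed
    then show "real (card (S \<inter> {a..b})) / real_of_int (b - a + 1)
      \<le> (Mchi S (n - 1) + Mchi S (n + 1)) / 2" by (simp add: c_def L_def mult.commute)
  qed
  then show ?thesis by simp
qed

text \<open>An interval of length L starting at n + 1 has c <= L - 1 points of S, so extending it to
  n lowers its average by c/(L(L + 1)) <= 1/4. Increments towards both sides of a point then add up
  to at most 1/2.\<close>

lemma maximal_Suc_off_le:
  assumes "n \<notin> S" "n + 1 \<notin> S"
  shows "Mchi S (n + 1) \<le> Mchi S n + 1 / 4"
proof (rule maximal_leI)
  fix a b assume ab: "a \<le> n + 1" "n + 1 \<le> b"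
  define c L where "c = real (card (S \<inter> {a..b}))" and "L = real_of_int (b - a + 1)"
  have L: "L \<ge> 1" using ab by (simp add: L_def)
  show "real (card (S \<inter> {a..b})) / real_of_int (b - a + 1) \<le> Mchi S n + 1 / 4"
  proof (cases "a \<le> n")
    case True
    then show ?thesis using average_le_maximal[of a n b S] ab by simp
  next
    case False
    then have a: "a = n + 1" using ab by simp
    have "c \<le> L - 1"
      using card_Int_le_remove_left[OF assms(2), of b] ab by (simp add: a c_def L_def)
    \<comment> \<open>By c <= L - 1 it suffices that L^2 - 3L + 4 = ((2L - 3)^2 + 7)/4 is
      nonnegative.\<close>
    then have "4 * c \<le> L * (L + 1)"
      using zero_le_power2[of "2 * L - 3"]
      by (simp add: algebra_simps power2_eq_square)
    then have "c / L \<le> c / (L + 1) + 1 / 4" using L by (simp add: field_simps)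
    also have "c / (L + 1) \<le> Mchi S n"
      using average_le_maximal[of n n b S] card_Int_remove_left[OF assms(1), of b] ab
      by (simp add: a c_def L_def algebra_simps)
    finally show ?thesis by (simp add: c_def L_def)
  qed
qed

text \<open>As M(n - 1) = 1, the claim is M(n + 1) <= 2 M(n) - 1/2. Since M(n) >= 1/2, this is clear
  for intervals containing n and for averages up to 1/2. A denser interval starting at n + 1 is
  extended to n - 1, gaining two places and one point of S.\<close>

lemma maximal_second_difference_right_of_set:
  assumes "n - 1 \<in> S" "n \<notin> S" "n + 1 \<notin> S"
  shows "Mchi S (n - 1) + Mchi S (n + 1) - 2 * Mchi S n \<le> 1 / 2"
proof -
  have M: "1 / 2 \<le> Mchi S n" using assms by (intro maximal_ge_half) simp
  have "Mchi S (n + 1) \<le> 2 * Mchi S n - 1 / 2"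
  proof (rule maximal_leI)
    fix a b assume ab: "a \<le> n + 1" "n + 1 \<le> b"
    define c L where "c = real (card (S \<inter> {a..b}))" and "L = real_of_int (b - a + 1)"
    have L: "L \<ge> 1" using ab by (simp add: L_def)
    show "real (card (S \<inter> {a..b})) / real_of_int (b - a + 1) \<le> 2 * Mchi S n - 1 / 2"
    proof (cases "a \<le> n")
      case True
      then show ?thesis using average_le_maximal[of a n b S] ab M by simp
    next
      case False
      then have a: "a = n + 1" using ab by simp
      have "c \<le> L - 1"
        using card_Int_le_remove_left[OF assms(3), of b] ab by (simp add: a c_def L_def)
      have "c / L \<le> 2 * Mchi S n - 1 / 2"
      proof (cases "2 * c \<le> L")
        case True
        then have "c / L \<le> 1 / 2" using L by (simp add: field_simps)
        then show ?thesis using M by linarith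
      next
        case False
        then have "L \<ge> 2" using \<open>c \<le> L - 1\<close> by (simp add: c_def)
        \<comment> \<open>This is the next inequality with its denominators cleared.\<close>
        then have "L * (L - 2) \<le> 2 * c * (L - 2)"
          using False by (intro mult_right_mono) auto
        then have "c / L + 1 / 2 \<le> 2 * ((c + 1) / (L + 2))"
          using L by (simp add: field_simps)
        also have "card (S \<inter> {n - 1..b}) = card (S \<inter> {n + 1..b}) + 1"
        proof -
          have "S \<inter> {n - 1..b} = insert (n - 1) (S \<inter> {n..b})"
            using assms(1) ab by (auto simp: order_le_less)
          then show ?thesis using card_Int_remove_left[OF assms(2), of b] by simp
        qed
        then have "(c + 1) / (L + 2) \<le> Mchi S n"
          using average_le_maximal[of "n - 1" n b S] ab by (simp add: a c_def L_def algebra_simps)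
        finally show ?thesis by simp
      qed
      then show ?thesis by (simp add: c_def L_def)
    qed
  qed
  then show ?thesis using maximal_eq_1[OF assms(1)] by simp
qed

text \<open>One neighbour in S is the previous lemma or its mirror image; with none, both increments
  away from n are at most 1/4. Gaps of length one are excluded: S = {0, 2} gives 2/3 at n =
  1.\<close>

lemma maximal_second_difference_off_le:
  assumes "n \<notin> S" "\<not> (n - 1 \<in> S \<and> n + 1 \<in> S)"
  shows "Mchi S (n - 1) + Mchi S (n + 1) - 2 * Mchi S n \<le> 1 / 2"
proof -
  have mem: "k \<in> uminus ` S \<longleftrightarrow> - k \<in> S" for k by force
  consider "n - 1 \<in> S" "n + 1 \<notin> S" | "n - 1 \<notin> S" "n + 1 \<in> S" | "n - 1 \<notin> S" "n + 1 \<notin> S"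
    using assms(2) by blast
  then show ?thesis
  proof cases
    case 1
    then show ?thesis using assms(1) by (intro maximal_second_difference_right_of_set)
  next
    case 2
    then show ?thesis
      using maximal_second_difference_right_of_set[of "- n" "uminus ` S"] assms(1)
      by (simp add: mem maximal_uminus add.commute)
  next
    case 3
    then show ?thesis
      using maximal_Suc_off_le[of n S] maximal_Suc_off_le[of "- n" "uminus ` S"] assms(1)
      by (simp add: mem maximal_uminus add.commute)
  qed
qed

section \<open>Pointwise comparison of the second differences\<close>

abbreviation ddiff2 :: "(int \<Rightarrow> real) \<Rightarrow> int \<Rightarrow> real" where
  "ddiff2 f \<equiv> ddiff (ddiff f)"

text \<open>The second difference at k is centred at k + 1, which explains the index shift in the
  case distinctions below.\<close>

lemma ddiff2_eq: "ddiff2 f k = f k + f (k + 2) - 2 * f (k + 1)"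
  by (simp add: ddiff_def add.assoc)

text \<open>If the centre is in S, each neighbour outside S contributes 1 to the right-hand second
  difference and at most 1/2 to the left-hand one, with equal signs. In a gap of length one the
  values are 2 and 2 - 2 M(k + 1) <= 1.\<close>

lemma ddiff2_maximal_le_1:
  assumes "k + 1 \<in> S \<or> k \<in> S \<and> k + 2 \<in> S"
  shows "\<bar>ddiff2 (Mchi S) k\<bar> \<le> \<bar>ddiff2 (indicator S) k\<bar> / 2"
proof -
  have half: "1 / 2 \<le> Mchi S k" "1 / 2 \<le> Mchi S (k + 2)" if "k + 1 \<in> S"
    using maximal_ge_half[of k S] maximal_ge_half[of "k + 2" S] that by (simp_all add: add.commute)
  have half': "1 / 2 \<le> Mchi S (k + 1)" if "k \<in> S"
    by (rule maximal_ge_half) (use that in simp)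
  show ?thesis
    using assms half half' maximal_le_1[of S k] maximal_le_1[of S "k + 1"]
      maximal_le_1[of S "k + 2"] maximal_eq_1[of k S] maximal_eq_1[of "k + 1" S]
      maximal_eq_1[of "k + 2" S]
    by (cases "k \<in> S"; cases "k + 1 \<in> S"; cases "k + 2 \<in> S")
       (auto simp: ddiff2_eq indicator_def)
qed

lemma ddiff2_maximal_off:
  assumes "k + 1 \<notin> S" "\<not> (k \<in> S \<and> k + 2 \<in> S)"
  shows "0 \<le> ddiff2 (Mchi S) k" "ddiff2 (Mchi S) k \<le> 1 / 2"
  using maximal_convex_off[OF assms(1)] maximal_second_difference_off_le[OF assms(1)] assms(2)
  by (simp_all add: ddiff2_eq add.commute)

text \<open>Setting the slope to 0 on every edge that meets S lets a single telescoping sum over an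
  integer interval treat all gaps at once, without splitting the complement of S into gaps.\<close>

definition gap_slope :: "int set \<Rightarrow> int \<Rightarrow> real" where
  "gap_slope S k = (if k \<in> S \<or> k + 1 \<in> S then 0 else Mchi S (k + 1) - Mchi S k)"

text \<open>The slope of the maximal function in a gap of \<open>S\<close> telescopes; at an end of the gap it is cut
  off, which costs \<open>1 - Mchi S (k + 1) \<le> 1 / 2\<close>, where \<open>\<chi>\<^sub>S''\<close> equals \<open>1\<close>.\<close>

lemma ddiff2_maximal_le_gap_slope:
  assumes "k + 1 \<notin> S" "\<not> (k \<in> S \<and> k + 2 \<in> S)"
  shows "ddiff2 (Mchi S) k \<le> \<bar>ddiff2 (indicator S) k\<bar> / 2 + (gap_slope S (k + 1) - gap_slope S k)"
proof -
  have half: "1 / 2 \<le> Mchi S (k + 1)" if "k \<in> S \<or> k + 2 \<in> S"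
    by (rule maximal_ge_half) (use that in \<open>simp add: add.commute\<close>)
  show ?thesis
    using assms half maximal_eq_1[of k S] maximal_eq_1[of "k + 2" S]
    by (cases "k \<in> S"; cases "k + 2 \<in> S")
       (auto simp: ddiff2_eq indicator_def gap_slope_def add.assoc)
qed

lemma ddiff2_maximal_powr_le:
  assumes "1 \<le> q"
  shows "\<bar>ddiff2 (Mchi S) k\<bar> powr q \<le>
    (1/2) powr q * \<bar>ddiff2 (indicator S) k\<bar> powr q
    + (1/2) powr (q - 1) * (gap_slope S (k + 1) - gap_slope S k)"
proof (cases "k + 1 \<in> S \<or> k \<in> S \<and> k + 2 \<in> S")
  case True
  have "\<bar>ddiff2 (Mchi S) k\<bar> powr q \<le> (1/2 * \<bar>ddiff2 (indicator S) k\<bar>) powr q"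
    using ddiff2_maximal_le_1[OF True] assms by (intro powr_mono2) auto
  also have "\<dots> = (1/2) powr q * \<bar>ddiff2 (indicator S) k\<bar> powr q"
    by (rule powr_mult)
  \<comment> \<open>Each of the two edges at k + 1 meets S here, so both slopes vanish.\<close>
  finally show ?thesis using True by (auto simp: gap_slope_def add.assoc)
next
  case False
  define x y where "x = ddiff2 (Mchi S) k" and "y = \<bar>ddiff2 (indicator S) k\<bar>"
  have x: "0 \<le> x" "x \<le> 1 / 2" using ddiff2_maximal_off[of k S] False by (auto simp: x_def)
  \<comment> \<open>Here y is 0 or 1, hence equal to its own power.\<close>
  have y: "y powr q = y"
    using False by (auto simp: y_def ddiff2_eq indicator_def)
  have half: "(1/2) powr q = (1/2) powr (q - 1) * (1/2 :: real)"
    using powr_add[of "1/2::real" "q - 1" 1] by simp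
  have "\<bar>x\<bar> powr q = x powr (q - 1) * x"
    using x powr_add[of x "q - 1" 1] by (cases "x = 0") auto
  also have "\<dots> \<le> (1/2) powr (q - 1) * x"
    using x assms by (intro mult_right_mono powr_mono2) auto
  also have "\<dots> \<le> (1/2) powr (q - 1) * (y / 2 + (gap_slope S (k + 1) - gap_slope S k))"
    using ddiff2_maximal_le_gap_slope[of k S] False
    by (intro mult_left_mono) (auto simp: x_def y_def)
  also have "\<dots> = (1/2) powr q * y powr q
      + (1/2) powr (q - 1) * (gap_slope S (k + 1) - gap_slope S k)"
    by (simp add: y half algebra_simps)
  finally show ?thesis by (simp add: x_def y_def)
qed

text \<open>If S has no point from n on, intervals starting at n + 1 have average 0 and all others
  reaching n + 1 contain n, so M does not increase. This and its mirror image give the boundary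
  terms of the telescoped sum the right sign.\<close>

lemma gap_slope_nonpos:
  assumes "\<And>k. k \<ge> n \<Longrightarrow> k + 1 \<in> S \<longleftrightarrow> k \<in> S"
  shows "gap_slope S n \<le> 0"
proof (cases "n \<in> S")
  case False
  have notin: "k \<notin> S" if "n \<le> k" for k
    using that by (induction rule: int_ge_induct) (use False assms in auto)
  have "Mchi S (n + 1) \<le> Mchi S n"
  proof (rule maximal_leI)
    fix a b assume ab: "a \<le> n + 1" "n + 1 \<le> b"
    show "real (card (S \<inter> {a..b})) / real_of_int (b - a + 1) \<le> Mchi S n"
    proof (cases "a \<le> n")
      case True
      then show ?thesis using average_le_maximal[of a n b S] ab by simp
    next
      case False
      then have "S \<inter> {a..b} = {}" using notin by force
      then show ?thesis using maximal_nonneg by simp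
    qed
  qed
  then show ?thesis by (simp add: gap_slope_def)
qed (simp add: gap_slope_def)

text \<open>The edge from k to k + 1 is reflected to the edge starting at -k - 1, with its direction
  reversed.\<close>

lemma gap_slope_uminus: "gap_slope (uminus ` S) (- k - 1) = - gap_slope S k"
proof -
  have "j \<in> uminus ` S \<longleftrightarrow> - j \<in> S" for j by force
  then show ?thesis by (auto simp: gap_slope_def maximal_uminus add.commute)
qed

lemma gap_slope_nonneg:
  assumes "\<And>k. k \<le> n \<Longrightarrow> k \<in> S \<longleftrightarrow> k + 1 \<in> S"
  shows "0 \<le> gap_slope S n"
proof -
  have mem: "j \<in> uminus ` S \<longleftrightarrow> - j \<in> S" for j by force
  have "gap_slope (uminus ` S) (- n - 1) \<le> 0"
  proof (rule gap_slope_nonpos)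
    fix k assume "k \<ge> - n - 1"
    then show "k + 1 \<in> uminus ` S \<longleftrightarrow> k \<in> uminus ` S"
      using assms[of "- k - 1"] by (simp add: mem)
  qed
  then show ?thesis by (simp add: gap_slope_uminus)
qed

section \<open>The upper bound for the norms\<close>

lemma sum_telescope_int:
  fixes g :: "int \<Rightarrow> real"
  assumes "a \<le> b"
  shows "(\<Sum>k\<in>{a..b}. g (k + 1) - g k) = g (b + 1) - g a"
  using assms
proof (induction b rule: int_ge_induct)
  case (step b)
  have "{a..b + 1} = insert (b + 1) {a..b}" using step by auto
  then show ?case using step by simp
qed simp

lemma ennreal_infsum_le:
  fixes f :: "'a \<Rightarrow> ennreal"
  assumes "\<And>F. finite F \<Longrightarrow> sum f F \<le> C"
  shows "infsum f UNIV \<le> C"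
  by (subst nonneg_infsum_complete) (auto intro!: SUP_least assms)

lemma ennreal_sum_le_infsum:
  fixes f :: "'a \<Rightarrow> ennreal"
  assumes "finite F"
  shows "sum f F \<le> infsum f UNIV"
  using assms by (auto simp: nonneg_infsum_complete intro!: SUP_upper)

text \<open>Taking q-th roots is done once here; if the sum for f is infinite, so is the right-hand
  side, because c > 0.\<close>

lemma lp_norm_le_mult:
  assumes "0 < q" "0 < c"
    and le: "(\<Sum>\<^sub>\<infinity>n\<in>UNIV. ennreal (\<bar>g n\<bar> powr q)) \<le>
      ennreal (c powr q) * (\<Sum>\<^sub>\<infinity>n\<in>UNIV. ennreal (\<bar>f n\<bar> powr q))"
  shows "lp_norm (ennreal q) g \<le> ennreal c * lp_norm (ennreal q) f"
proof (cases "(\<Sum>\<^sub>\<infinity>n\<in>UNIV. ennreal (\<bar>f n\<bar> powr q))")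
  case (real b)
  then obtain a where a: "0 \<le> a" "(\<Sum>\<^sub>\<infinity>n\<in>UNIV. ennreal (\<bar>g n\<bar> powr q)) = ennreal a"
    using le by (cases "\<Sum>\<^sub>\<infinity>n\<in>UNIV. ennreal (\<bar>g n\<bar> powr q)")
      (auto simp: ennreal_mult[symmetric] top_unique)
  have "a \<le> c powr q * b" using le real a by (simp add: ennreal_mult[symmetric])
  then have "a powr (1 / q) \<le> (c powr q * b) powr (1 / q)"
    using a assms by (intro powr_mono2) auto
  also have "\<dots> = c * b powr (1 / q)"
    using assms real by (simp add: powr_mult powr_powr)
  finally show ?thesis
    using assms a real by (simp add: lp_norm_def ennreal_mult[symmetric] less_imp_le)
next
  case top
  then show ?thesis using assms by (simp add: lp_norm_def ennreal_mult_top)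
qed

text \<open>The second difference of a characteristic function is integer-valued, so infinitely many
  nonzero values would make the sum of powers infinite.\<close>

lemma finite_support_ddiff2:
  assumes "0 < q" "lp_norm (ennreal q) (ddiff2 (indicator S)) < \<infinity>"
  shows "finite {k. ddiff2 (indicator S) k \<noteq> 0}"
proof (rule ccontr)
  let ?T = "{k. ddiff2 (indicator S) k \<noteq> 0}"
  let ?u = "\<lambda>k. ennreal (\<bar>ddiff2 (indicator S) k\<bar> powr q)"
  assume inf: "infinite ?T"
  have "1 \<le> ?u k" if "k \<in> ?T" for k
  proof -
    have "1 \<le> \<bar>ddiff2 (indicator S) k\<bar>" using that by (auto simp: ddiff2_eq indicator_def split: if_splits)
    then show ?thesis using assms(1) by (simp add: ge_one_powr_ge_zero)
  qed
  then have "infsum ?u ?T = \<infinity>"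
    by (rule infsum_superconst_infinite_ennreal[where b = 1]) (use inf in auto)
  moreover have "infsum ?u ?T \<le> infsum ?u UNIV" by (rule infsum_mono_neutral) (auto intro: nonneg_summable_on_complete)
  ultimately have "infsum ?u UNIV = \<infinity>" by (simp add: top_unique)
  then show False using assms by (simp add: lp_norm_def)
qed

lemma maximal_lp_bound_finite:
  assumes "1 \<le> q" "lp_norm (ennreal q) (ddiff2 (indicator S)) < \<infinity>"
  shows "lp_norm (ennreal q) (ddiff2 (Mchi S)) \<le> ennreal (1/2) * lp_norm (ennreal q) (ddiff2 (indicator S))"
proof (rule lp_norm_le_mult)
  have "finite {k. ddiff2 (indicator S) k \<noteq> 0}"
    using assms by (intro finite_support_ddiff2) auto
  then obtain N where N: "abs ` {k. ddiff2 (indicator S) k \<noteq> 0} \<subseteq> {..<N}"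
    by (auto simp: finite_int_iff_bounded)
  then have zero: "ddiff2 (indicator S) k = 0" if "N \<le> \<bar>k\<bar>" for k
    using that by force
  \<comment> \<open>For values in {0, 1}, a vanishing second difference forces all three values to
    agree.\<close>
  have const: "(k \<in> S \<longleftrightarrow> k + 1 \<in> S) \<and> (k + 1 \<in> S \<longleftrightarrow> k + 2 \<in> S)" if "N \<le> \<bar>k\<bar>" for k
    using zero[OF that]
    by (cases "k \<in> S"; cases "k + 1 \<in> S"; cases "k + 2 \<in> S") (simp_all add: ddiff2_eq)
  show "(\<Sum>\<^sub>\<infinity>n\<in>UNIV. ennreal (\<bar>ddiff2 (Mchi S) n\<bar> powr q)) \<le>
      ennreal ((1/2) powr q) * (\<Sum>\<^sub>\<infinity>n\<in>UNIV. ennreal (\<bar>ddiff2 (indicator S) n\<bar> powr q))"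
  proof (rule ennreal_infsum_le)
    fix F :: "int set" assume "finite F"
    then obtain K0 where "abs ` F \<subseteq> {..<K0}" by (auto simp: finite_int_iff_bounded)
    define K where "K = max (max K0 N) 0"
    have K: "0 \<le> K" "N \<le> K" "F \<subseteq> {-K..K}"
      using \<open>abs ` F \<subseteq> {..<K0}\<close> unfolding K_def by force+
    have G1: "gap_slope S (K + 1) \<le> 0"
    proof (rule gap_slope_nonpos)
      show "k + 1 \<in> S \<longleftrightarrow> k \<in> S" if "K + 1 \<le> k" for k using const[of k] that K by linarith
    qed
    have G2: "0 \<le> gap_slope S (- K)"
    proof (rule gap_slope_nonneg)
      show "k \<in> S \<longleftrightarrow> k + 1 \<in> S" if "k \<le> - K" for k using const[of k] that K by linarith
    qed
    have "(\<Sum>k\<in>F. \<bar>ddiff2 (Mchi S) k\<bar> powr q) \<le> (\<Sum>k\<in>{-K..K}. \<bar>ddiff2 (Mchi S) k\<bar> powr q)"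
      using K by (intro sum_mono2) auto
    also have "\<dots> \<le> (\<Sum>k\<in>{-K..K}. (1/2) powr q * \<bar>ddiff2 (indicator S) k\<bar> powr q
        + (1/2) powr (q - 1) * (gap_slope S (k + 1) - gap_slope S k))"
      by (intro sum_mono ddiff2_maximal_powr_le assms)
    also have "\<dots> = (1/2) powr q * (\<Sum>k\<in>{-K..K}. \<bar>ddiff2 (indicator S) k\<bar> powr q)
        + (1/2) powr (q - 1) * (gap_slope S (K + 1) - gap_slope S (- K))"
      using K sum_telescope_int[of "-K" K "gap_slope S"]
      by (simp add: sum.distrib flip: sum_distrib_left)
    also have "\<dots> \<le> (1/2) powr q * (\<Sum>k\<in>{-K..K}. \<bar>ddiff2 (indicator S) k\<bar> powr q)"
      using G1 G2 by (simp add: mult_nonneg_nonpos)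
    finally have "(\<Sum>k\<in>F. ennreal (\<bar>ddiff2 (Mchi S) k\<bar> powr q)) \<le>
        ennreal ((1/2) powr q) * (\<Sum>k\<in>{-K..K}. ennreal (\<bar>ddiff2 (indicator S) k\<bar> powr q))"
      by (simp add: ennreal_mult[symmetric] sum_nonneg)
    also have "\<dots> \<le> ennreal ((1/2) powr q) *
        (\<Sum>\<^sub>\<infinity>n\<in>UNIV. ennreal (\<bar>ddiff2 (indicator S) n\<bar> powr q))"
      by (intro mult_left_mono ennreal_sum_le_infsum) auto
    finally show "(\<Sum>k\<in>F. ennreal (\<bar>ddiff2 (Mchi S) k\<bar> powr q)) \<le> \<dots>" .
  qed
qed (use assms in auto)

text \<open>Off S the pointwise comparison can fail, but for the supremum a value up to 1/2 may be
  compared with any j at which the second difference of the characteristic function is at least 1 in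
  absolute value.\<close>

lemma maximal_lp_bound_infinite:
  "lp_norm \<infinity> (ddiff2 (Mchi S)) \<le> ennreal (1/2) * lp_norm \<infinity> (ddiff2 (indicator S))"
proof -
  have *: "ennreal \<bar>ddiff2 (Mchi S) k\<bar> \<le> ennreal (1/2) * lp_norm \<infinity> (ddiff2 (indicator S))"
    if "\<bar>ddiff2 (Mchi S) k\<bar> \<le> \<bar>ddiff2 (indicator S) j\<bar> / 2" for k j
  proof -
    have "ennreal \<bar>ddiff2 (Mchi S) k\<bar> \<le> ennreal (1/2) * ennreal \<bar>ddiff2 (indicator S) j\<bar>"
      using that by (subst ennreal_mult[symmetric]) auto
    also have "\<dots> \<le> ennreal (1/2) * lp_norm \<infinity> (ddiff2 (indicator S))"
      unfolding lp_norm_def by (auto intro!: mult_left_mono SUP_upper)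
    finally show ?thesis .
  qed
  have "ennreal \<bar>ddiff2 (Mchi S) k\<bar> \<le> ennreal (1/2) * lp_norm \<infinity> (ddiff2 (indicator S))" for k
  proof (cases "k + 1 \<in> S \<or> k \<in> S \<and> k + 2 \<in> S")
    case True
    then show ?thesis by (intro *[of k k] ddiff2_maximal_le_1)
  next
    case False
    then have le: "\<bar>ddiff2 (Mchi S) k\<bar> \<le> 1 / 2" using ddiff2_maximal_off[of k S] by auto
    show ?thesis
    proof (cases "\<exists>j. (j \<in> S) \<noteq> (j + 1 \<in> S)")
      case True
      then obtain j where "(j \<in> S) \<noteq> (j + 1 \<in> S)" by blast
      \<comment> \<open>Two consecutive equal jumps would leave {0, 1}, so a jump cannot be
        cancelled in the second difference.\<close>
      then have "1 \<le> \<bar>ddiff2 (indicator S) (j - 1)\<bar> \<or> 1 \<le> \<bar>ddiff2 (indicator S) j\<bar>"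
        by (auto simp: ddiff2_eq indicator_def)
      then show ?thesis using le *[of k "j - 1"] *[of k j] by fastforce
    next
      case const: False
      have "j \<notin> S" for j
      proof (induction j rule: int_induct[where k = "k + 1"])
        case (step2 i)
        then show ?case using const[simplified, rule_format, of "i - 1"] by simp
      qed (use False const in auto)
      then have "S = {}" by blast
      then have "Mchi S j \<le> 0" for j by (intro maximal_leI) simp
      then have "Mchi S j = 0" for j using maximal_nonneg[of S j] by (simp add: antisym)
      then show ?thesis by (simp add: ddiff2_eq)
    qed
  qed
  then show ?thesis by (simp add: lp_norm_def SUP_le_iff)
qed

lemma maximal_lp_bound:
  assumes "1 \<le> p" "lp_norm p (ddiff2 (indicator S)) < \<infinity>"
  shows "lp_norm p (ddiff2 (Mchi S)) \<le> ennreal (1/2) * lp_norm p (ddiff2 (indicator S))"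
proof (cases p)
  case (real q)
  then show ?thesis using assms maximal_lp_bound_finite[of q S] by (simp del: ennreal_half)
next
  case top
  then show ?thesis using maximal_lp_bound_infinite by simp
qed

section \<open>The sets S_m and the lower bound\<close>

lemma infsum_eq_sum_support:
  fixes f :: "'a \<Rightarrow> ennreal"
  assumes "finite A" "\<And>x. x \<notin> A \<Longrightarrow> f x = 0"
  shows "infsum f UNIV = sum f A"
proof -
  have "infsum f UNIV = infsum f A" by (rule infsum_cong_neutral) (use assms in auto)
  then show ?thesis using assms by simp
qed

lemma lp_norm_pos:
  assumes "1 \<le> p" "f k \<noteq> 0"
  shows "0 < lp_norm p f"
proof (cases p)
  case (real q)
  let ?s = "\<Sum>\<^sub>\<infinity>n\<in>UNIV. ennreal (\<bar>f n\<bar> powr q)"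
  have "0 < ennreal (\<bar>f k\<bar> powr q)" using assms by simp
  also have "\<dots> \<le> ?s" using ennreal_sum_le_infsum[of "{k}" "\<lambda>n. ennreal (\<bar>f n\<bar> powr q)"] by simp
  finally have "0 < ?s" .
  then have "enn2real ?s \<noteq> 0" if "?s \<noteq> \<infinity>"
    using that by (simp add: enn2real_eq_0_iff)
  then show ?thesis using real by (simp add: lp_norm_def Let_def)
next
  case top
  have "0 < ennreal \<bar>f k\<bar>" using assms by simp
  also have "\<dots> \<le> lp_norm p f" by (auto simp: top lp_norm_def intro: SUP_upper)
  finally show ?thesis .
qed

lemma lp_norm_finite_support:
  assumes "1 \<le> p" "finite A" "\<And>k. k \<notin> A \<Longrightarrow> f k = 0"
  shows "lp_norm p f < \<infinity>"
proof (cases p)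
  case (real q)
  have "(\<Sum>\<^sub>\<infinity>n\<in>UNIV. ennreal (\<bar>f n\<bar> powr q)) = (\<Sum>n\<in>A. ennreal (\<bar>f n\<bar> powr q))"
    using assms by (intro infsum_eq_sum_support) auto
  then show ?thesis using real by (simp add: lp_norm_def)
next
  case top
  have "ennreal \<bar>f k\<bar> \<le> (\<Sum>n\<in>A. ennreal \<bar>f n\<bar>)" for k
    using assms(2,3) by (cases "k \<in> A") (auto intro!: member_le_sum)
  then have "lp_norm p f \<le> (\<Sum>n\<in>A. ennreal \<bar>f n\<bar>)" by (simp add: top lp_norm_def SUP_le_iff)
  also have "\<dots> < \<infinity>" by simp
  finally show ?thesis .
qed

text \<open>Pairing each point of \<open>S\<close> in an interval around \<open>n\<close> with its neighbour in the direction of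
  \<open>n\<close> shows that at most half of the interval lies in \<open>S\<close>.\<close>

lemma maximal_le_half:
  assumes "\<And>x y. x \<in> S \<Longrightarrow> y \<in> S \<Longrightarrow> x < y \<Longrightarrow> x + 3 \<le> y" "n \<notin> S"
  shows "Mchi S n \<le> 1 / 2"
proof (rule maximal_leI)
  fix a b assume ab: "a \<le> n" "n \<le> b"
  define h where "h x = (if x < n then x + 1 else x - 1)" for x
  let ?A = "S \<inter> {a..b}"
  \<comment> \<open>Two points sharing a neighbour would be at distance 2; the spacing of at least 3
    rules this out.\<close>
  have "inj_on h ?A"
  proof (rule inj_onI)
    fix x y assume "x \<in> ?A" "y \<in> ?A" "h x = h y"
    then show "x = y"
      using assms(1)[of x y] assms(1)[of y x] by (auto simp: h_def split: if_splits)
  qed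
  moreover have disj: "?A \<inter> h ` ?A = {}"
  proof -
    have "h x \<notin> S" if "x \<in> S" for x
      using that assms(1)[of x "h x"] assms(1)[of "h x" x] by (auto simp: h_def split: if_splits)
    then show ?thesis by auto
  qed
  moreover have "h ` ?A \<subseteq> {a..b}"
  proof (rule image_subsetI)
    fix x assume "x \<in> ?A"
    moreover from this have "x \<noteq> n" using assms(2) by auto
    ultimately show "h x \<in> {a..b}" using ab by (auto simp: h_def)
  qed
  ultimately have "2 * card ?A \<le> card {a..b}"
    using card_mono[of "{a..b}" "?A \<union> h ` ?A"] card_Un_disjoint[OF _ _ disj] card_image[of h ?A]
    by simp
  then show "real (card ?A) / real_of_int (b - a + 1) \<le> 1 / 2"
    using ab by (simp add: divide_le_eq)
qed

lemma mem_S_ext_iff: "n \<in> S_ext m \<longleftrightarrow> 0 \<le> n \<and> n < 3 * int m \<and> 3 dvd n"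
proof
  assume n: "0 \<le> n \<and> n < 3 * int m \<and> 3 dvd n"
  then obtain k where "n = 3 * k" by blast
  with n have "n = 3 * int (nat k)" "nat k < m" by auto
  then show "n \<in> S_ext m" unfolding S_ext_def by blast
qed (auto simp: S_ext_def)

lemma ddiff2_S_ext_eq_0:
  assumes "k \<notin> {-2..3 * int m - 3}"
  shows "ddiff2 (indicator (S_ext m)) k = 0"
proof -
  have "x \<notin> S_ext m" if "x \<in> {k, k + 1, k + 2}" for x
  proof
    assume x: "x \<in> S_ext m"
    then have "x \<le> 3 * int m - 3" by (auto simp: S_ext_def)
    then show False using x assms that by (auto simp: mem_S_ext_iff)
  qed
  then show ?thesis by (simp add: ddiff2_eq)
qed

text \<open>The centre k + 1 runs from 0 to 3(m - 1), so every gap point between has M = 1/2. A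
  centre in S gives -2 against at most -1; a centre in a gap gives 1 against at least 1/2.\<close>

lemma ddiff2_S_ext_inner:
  assumes "k \<in> {-1..3 * int m - 4}"
  shows "1 \<le> \<bar>ddiff2 (indicator (S_ext m)) k\<bar>"
    and "\<bar>ddiff2 (indicator (S_ext m)) k\<bar> \<le> 2 * \<bar>ddiff2 (Mchi (S_ext m)) k\<bar>"
proof -
  let ?S = "S_ext m"
  have off: "Mchi ?S n \<le> 1 / 2" if "n \<notin> ?S" for n
    by (rule maximal_le_half) (use that in \<open>auto simp: S_ext_def\<close>)
  have "k mod 3 = 2 \<or> k mod 3 = 0 \<or> k mod 3 = 1" by presburger
  then consider "k mod 3 = 2" | "k mod 3 = 0" | "k mod 3 = 1" by blast
  then consider "k + 1 \<in> ?S" "k \<notin> ?S" "k + 2 \<notin> ?S"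
    | "k \<in> ?S" "k + 1 \<notin> ?S" "k + 2 \<notin> ?S" "k + 3 \<in> ?S"
    | "k + 2 \<in> ?S" "k + 1 \<notin> ?S" "k \<notin> ?S" "k - 1 \<in> ?S"
  proof cases
    case 1
    moreover from this have "3 dvd k + 1" "\<not> 3 dvd k" "\<not> 3 dvd k + 2" by presburger+
    ultimately show ?thesis using assms by (intro that(1)) (simp_all add: mem_S_ext_iff)
  next
    case 2
    then obtain j where "k = 3 * j" by auto
    moreover from 2 have "3 dvd k" "\<not> 3 dvd k + 1" "\<not> 3 dvd k + 2" "3 dvd k + 3" by presburger+
    ultimately show ?thesis using assms by (intro that(2)) (simp_all add: mem_S_ext_iff)
  next
    case 3
    then have "k = 3 * (k div 3) + 1" by presburger
    then obtain j where "k = 3 * j + 1" by blast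
    moreover from 3 have "3 dvd k + 2" "\<not> 3 dvd k + 1" "\<not> 3 dvd k" "3 dvd k - 1" by presburger+
    ultimately show ?thesis using assms by (intro that(3)) (simp_all add: mem_S_ext_iff)
  qed
  then have "1 \<le> \<bar>ddiff2 (indicator ?S) k\<bar> \<and> \<bar>ddiff2 (indicator ?S) k\<bar> \<le> 2 * \<bar>ddiff2 (Mchi ?S) k\<bar>"
  proof cases
    case 1
    then show ?thesis using off[of k] off[of "k + 2"] maximal_eq_1[of "k + 1" ?S]
      by (simp add: ddiff2_eq)
  next
    case 2
    moreover have "1 / 2 \<le> Mchi ?S (k + 2)"
      by (rule maximal_ge_half) (use 2 in \<open>simp add: add.commute\<close>)
    ultimately show ?thesis using off[of "k + 1"] maximal_eq_1[of k ?S]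
      by (simp add: ddiff2_eq)
  next
    case 3
    moreover have "1 / 2 \<le> Mchi ?S k"
      by (rule maximal_ge_half) (use 3 in simp)
    ultimately show ?thesis using off[of "k + 1"] maximal_eq_1[of "k + 2" ?S]
      by (simp add: ddiff2_eq)
  qed
  then show "1 \<le> \<bar>ddiff2 (indicator (S_ext m)) k\<bar>"
    and "\<bar>ddiff2 (indicator (S_ext m)) k\<bar> \<le> 2 * \<bar>ddiff2 (Mchi (S_ext m)) k\<bar>" by auto
qed

lemma ddiff2_S_ext_ends:
  assumes "1 \<le> m"
  shows "ddiff2 (indicator (S_ext m)) (-2) = 1"
    and "ddiff2 (indicator (S_ext m)) (3 * int m - 3) = 1"
proof -
  have "-2 \<notin> S_ext m" "-1 \<notin> S_ext m" "0 \<in> S_ext m" "3 * int m - 3 \<in> S_ext m"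
    "3 * int m - 2 \<notin> S_ext m" "3 * int m - 1 \<notin> S_ext m"
    using assms unfolding mem_S_ext_iff by presburger+
  then show "ddiff2 (indicator (S_ext m)) (-2) = 1"
    and "ddiff2 (indicator (S_ext m)) (3 * int m - 3) = 1" by (simp_all add: ddiff2_eq)
qed

text \<open>The inner range has 3m - 2 >= 2(m - 1) points, each contributing at least 1 to the sum
  of powers. The two end points add 2, so the full sum is at most m/(m - 1) times the inner
  one.\<close>

lemma S_ext_lower_bound_finite:
  assumes "1 \<le> q" "2 \<le> m"
  shows "lp_norm (ennreal q) (ddiff2 (indicator (S_ext m)))
    \<le> ennreal (2 * real m / (real m - 1)) * lp_norm (ennreal q) (ddiff2 (Mchi (S_ext m)))"
proof (rule lp_norm_le_mult)
  define u v I where "u k = \<bar>ddiff2 (indicator (S_ext m)) k\<bar> powr q"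
    and "v k = \<bar>ddiff2 (Mchi (S_ext m)) k\<bar> powr q"
    and "I = {-1..3 * int m - 4}" for k
  define c where "c = real m / (real m - 1)"
  have c: "1 \<le> c" using assms by (simp add: c_def)
  have "real (card I) * 1 \<le> sum u I"
    by (rule sum_bounded_below)
      (use assms ddiff2_S_ext_inner(1)[of _ m] in \<open>auto simp: u_def I_def intro!: ge_one_powr_ge_zero\<close>)
  then have I: "2 * (real m - 1) \<le> sum u I" using assms by (simp add: I_def)
  have "{-2..3 * int m - 3} = insert (-2) (insert (3 * int m - 3) I)"
    using assms by (auto simp: I_def)
  then have "sum u {-2..3 * int m - 3} = 2 + sum u I"
    using assms ddiff2_S_ext_ends[of m] by (simp add: I_def u_def)
  also have "\<dots> \<le> c * sum u I"
    using I assms by (simp add: c_def field_simps)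
  also have "sum u I \<le> (\<Sum>k\<in>I. 2 powr q * v k)"
  proof (rule sum_mono)
    fix k assume "k \<in> I"
    then have "u k \<le> (2 * \<bar>ddiff2 (Mchi (S_ext m)) k\<bar>) powr q"
      unfolding u_def using assms by (intro powr_mono2 ddiff2_S_ext_inner) (auto simp: I_def)
    then show "u k \<le> 2 powr q * v k" by (simp add: v_def powr_mult)
  qed
  also have "\<dots> = 2 powr q * sum v I" by (simp add: sum_distrib_left)
  \<comment> \<open>Since c >= 1 and q >= 1, c is at most its q-th power; this makes the final
    constant independent of q.\<close>
  also have "c * \<dots> \<le> c powr q * (2 powr q * sum v I)"
    using c assms powr_mono[of 1 q c] by (intro mult_right_mono) (auto simp: v_def sum_nonneg)
  also have "\<dots> = (2 * c) powr q * sum v I" using c by (simp add: powr_mult)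
  finally have le: "sum u {-2..3 * int m - 3} \<le> (2 * c) powr q * sum v I" using c by simp
  have "(\<Sum>\<^sub>\<infinity>n\<in>UNIV. ennreal (u n)) = (\<Sum>n\<in>{-2..3 * int m - 3}. ennreal (u n))"
    by (rule infsum_eq_sum_support) (use assms ddiff2_S_ext_eq_0 in \<open>auto simp: u_def\<close>)
  also have "\<dots> = ennreal (sum u {-2..3 * int m - 3})" by (simp add: u_def)
  also have "\<dots> \<le> ennreal ((2 * c) powr q * sum v I)" by (rule ennreal_leI[OF le])
  also have "\<dots> = ennreal ((2 * c) powr q) * (\<Sum>k\<in>I. ennreal (v k))"
    by (simp add: ennreal_mult v_def sum_nonneg)
  also have "\<dots> \<le> ennreal ((2 * c) powr q) * (\<Sum>\<^sub>\<infinity>n\<in>UNIV. ennreal (v n))"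
    by (intro mult_left_mono ennreal_sum_le_infsum) (auto simp: I_def)
  finally show "(\<Sum>\<^sub>\<infinity>n\<in>UNIV. ennreal (\<bar>ddiff2 (indicator (S_ext m)) n\<bar> powr q)) \<le>
      ennreal ((2 * real m / (real m - 1)) powr q) *
        (\<Sum>\<^sub>\<infinity>n\<in>UNIV. ennreal (\<bar>ddiff2 (Mchi (S_ext m)) n\<bar> powr q))"
    by (simp add: u_def v_def c_def)
qed (use assms in auto)

text \<open>The point -1, centred at 0, already attains the largest possible absolute value
  2.\<close>

lemma S_ext_lower_bound_infinite:
  assumes "1 \<le> m"
  shows "lp_norm \<infinity> (ddiff2 (indicator (S_ext m))) \<le> ennreal 2 * lp_norm \<infinity> (ddiff2 (Mchi (S_ext m)))"
proof -
  have "-1 \<notin> S_ext m" "0 \<in> S_ext m" "1 \<notin> S_ext m"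
    using assms unfolding mem_S_ext_iff by presburger+
  then have two: "\<bar>ddiff2 (indicator (S_ext m)) (-1)\<bar> = 2" by (simp add: ddiff2_eq)
  have "lp_norm \<infinity> (ddiff2 (indicator (S_ext m))) \<le> ennreal 2"
    unfolding lp_norm_def by (auto intro!: SUP_least ennreal_leI simp: ddiff2_eq indicator_def)
  also have "\<dots> \<le> ennreal (2 * \<bar>ddiff2 (Mchi (S_ext m)) (-1)\<bar>)"
    using ddiff2_S_ext_inner(2)[of "-1" m] assms two by (intro ennreal_leI) simp
  also have "\<dots> = ennreal 2 * ennreal \<bar>ddiff2 (Mchi (S_ext m)) (-1)\<bar>" by (rule ennreal_mult) auto
  also have "\<dots> \<le> ennreal 2 * lp_norm \<infinity> (ddiff2 (Mchi (S_ext m)))"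
    unfolding lp_norm_def by (auto intro!: mult_left_mono SUP_upper)
  finally show ?thesis .
qed

lemma S_ext_lower_bound:
  assumes "1 \<le> p" "2 \<le> m"
  shows "lp_norm p (ddiff2 (indicator (S_ext m)))
    \<le> ennreal (2 * real m / (real m - 1)) * lp_norm p (ddiff2 (Mchi (S_ext m)))"
proof (cases p)
  case (real q)
  then show ?thesis using assms by (auto intro!: S_ext_lower_bound_finite)
next
  case top
  have "lp_norm p (ddiff2 (indicator (S_ext m))) \<le> ennreal 2 * lp_norm p (ddiff2 (Mchi (S_ext m)))"
    using S_ext_lower_bound_infinite[of m] assms top by simp
  also have "\<dots> \<le> ennreal (2 * real m / (real m - 1)) * lp_norm p (ddiff2 (Mchi (S_ext m)))"
    using assms by (intro mult_right_mono ennreal_leI) (auto simp: field_simps)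
  finally show ?thesis .
qed

lemma S_ext_norm_finite_pos:
  assumes "1 \<le> p" "1 \<le> m"
  shows "lp_norm p (ddiff2 (indicator (S_ext m))) < \<infinity>"
    and "0 < lp_norm p (ddiff2 (indicator (S_ext m)))"
proof -
  show "lp_norm p (ddiff2 (indicator (S_ext m))) < \<infinity>"
    by (rule lp_norm_finite_support[of p "{-2..3 * int m - 3}"])
      (use assms ddiff2_S_ext_eq_0 in auto)
  show "0 < lp_norm p (ddiff2 (indicator (S_ext m)))"
    by (rule lp_norm_pos[of p _ "-2"]) (use assms ddiff2_S_ext_ends in auto)
qed

lemma S_ext_extremizing:
  assumes "1 \<le> p"
  shows "(\<lambda>m. lp_norm p (ddiff2 (Mchi (S_ext m))) / lp_norm p (ddiff2 (indicator (S_ext m))))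
    \<longlonglongrightarrow> ennreal (1 / 2)"
proof (rule tendsto_sandwich)
  let ?M = "\<lambda>m. lp_norm p (ddiff2 (Mchi (S_ext m)))"
  let ?F = "\<lambda>m. lp_norm p (ddiff2 (indicator (S_ext m)))"
  \<comment> \<open>The lower bound is (m - 1)/(2m), the reciprocal of the constant in
    \<open>S_ext_lower_bound\<close>.\<close>
  have both: "ennreal (1 / 2 - inverse (real m) / 2) \<le> ?M m / ?F m \<and> ?M m / ?F m \<le> ennreal (1 / 2)"
    if m: "2 \<le> m" for m
  proof -
    have F: "?F m < \<infinity>" "0 < ?F m" using S_ext_norm_finite_pos[of p m] assms m by auto
    then obtain x where x: "?F m = ennreal x" "0 < x"
      by (cases "?F m") (auto simp: ennreal_zero_less_top)
    have "?M m \<le> ennreal (1 / 2) * ?F m" using F by (intro maximal_lp_bound assms)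
    also have "\<dots> = ennreal (1 / 2 * x)" unfolding x by (subst ennreal_mult) (use x in auto)
    finally have up: "?M m \<le> ennreal (1 / 2 * x)" .
    then obtain y where y: "?M m = ennreal y" "0 \<le> y"
      by (cases "?M m") (auto simp: top_unique)
    have "y \<le> 1 / 2 * x" using up x y by simp
    moreover have "x \<le> 2 * real m / (real m - 1) * y"
      using S_ext_lower_bound[OF assms m] x y m by (simp add: ennreal_mult[symmetric])
    ultimately have "1 / 2 - inverse (real m) / 2 \<le> y / x" "y / x \<le> 1 / 2"
      using x m by (simp_all add: field_simps)
    then show ?thesis using x y by (auto simp: divide_ennreal intro!: ennreal_leI simp del: ennreal_half)
  qed
  show "\<forall>\<^sub>F m in sequentially. ennreal (1 / 2 - inverse (real m) / 2) \<le> ?M m / ?F m"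
    "\<forall>\<^sub>F m in sequentially. ?M m / ?F m \<le> ennreal (1 / 2)"
    using both by (auto simp: eventually_sequentially)
  have "(\<lambda>m. 1 / 2 - inverse (real m) / 2) \<longlonglongrightarrow> 1 / 2 - 0 / 2"
    by (intro tendsto_intros lim_inverse_n) auto
  then show "(\<lambda>m. ennreal (1 / 2 - inverse (real m) / 2)) \<longlonglongrightarrow> ennreal (1 / 2)"
    by (intro tendsto_ennrealI) simp
qed simp

section \<open>The value of the constant and the limit\<close>

theorem theorem2p5:
  fixes p :: ennreal
  assumes "1 \<le> p"
  shows "C2 p = 1 / 2 \<and>
    (\<lambda>m. lp_norm p (ddiff (ddiff (maximal_fun (indicator (S_ext m))))) /
         lp_norm p (ddiff (ddiff (indicator (S_ext m))))) \<longlonglongrightarrow> C2 p"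
proof -
  let ?M = "\<lambda>S. lp_norm p (ddiff2 (Mchi S))"
  let ?F = "\<lambda>S. lp_norm p (ddiff2 (indicator S))"
  have half: "ennreal (1 / 2) = 1 / 2"
    by (metis divide_ennreal ennreal_1 ennreal_numeral zero_le_one zero_less_numeral)
  have lim: "(\<lambda>m. ?M (S_ext m) / ?F (S_ext m)) \<longlonglongrightarrow> 1 / 2"
    using S_ext_extremizing[OF assms] half by metis
  have "C2 p = 1 / 2"
    unfolding C2_def
  proof (rule Least_equality)
    show "\<forall>S. ?F S < \<infinity> \<longrightarrow> ?M S \<le> 1 / 2 * ?F S"
      using maximal_lp_bound[OF assms] half by metis
  next
    fix C assume C: "\<forall>S. ?F S < \<infinity> \<longrightarrow> ?M S \<le> C * ?F S"
    \<comment> \<open>For m >= 1 the denominator is positive and finite, so every admissible C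
      dominates the ratios and hence their limit 1/2.\<close>
    have "?M (S_ext m) / ?F (S_ext m) \<le> C" if "1 \<le> m" for m
      using C S_ext_norm_finite_pos[OF assms that]
      by (intro divide_le_posI_ennreal) (auto simp: mult.commute)
    then show "1 / 2 \<le> C" by (intro LIMSEQ_le_const2[OF lim]) blast
  qed
  then show ?thesis using lim by simp
qed

end
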